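(* Let $G$ be a simple directed graph on the vertices $1,2,\ldots,n$, with weight $a_{ij}$ attached to each edge $ij$ from $i$ to $j$, and with weighted adjacency matrix $A=(a_{ij})$, degree matrix $D$ and Laplacian $L=D-A$. Let $\mathbf{w}=(w_1,\ldots,w_n)^t$ be the weight vector of $G$, i.e. $w_i=\sum_{t}\mathrm{wt}(t)$, the sum being over all $i$-trees $t$ of $G$. Then $\mathbf{w}$ is harmonic, i.e. $L\mathbf{w}=\mathbf{0}$.
   Context: A simple directed graph (digraph) has no loops and at most one edge from $i$ to $j$ for each ordered pair $(i,j)$ with $i\neq j$; both $ij$ and $ji$ may be edges. The edge weights $a_{ij}$ are elements of a commutative ring with $1$ (e.g. real numbers or indeterminates). The weighted adjacency matrix of $G$ is the $n\times n$ matrix $A=(a_{ij})$, where $a_{ij}=0$ if $ij$ is not an edge of $G$ (in particular $a_{ii}=0$). The degree matrix $D$ is the diagonal matrix with diagonal entries $(d_1,\ldots,d_n)$, where $d_i=\sum_j a_{ji}$ is the (weighted) in-degree of the vertex $i$. The Laplacian of $G$ is $L=D-A$. A vector $\mathbf{x}=(x_i)$ is called harmonic if $L\mathbf{x}=\mathbf{0}$. A directed tree (arborescence) is a digraph with at most one incoming edge at each vertex and whose underlying undirected graph is a tree, i.e. connected and acyclic (a pair of opposite edges $ij$, $ji$ counts as a cycle, so is not allowed). Following edges backwards from any vertex one always arrives at the same vertex, called the root; it is the unique vertex with no incoming edge. An $i$-tree of $G$ is a directed spanning tree of $G$ (a subgraph of $G$ containing all the vertices $1,\ldots,n$ that is a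 directed tree) with root $i$. The weight $\mathrm{wt}(\Gamma)$ of a subgraph $\Gamma$ of $G$ is the product of the weights of all the edges of $\Gamma$ (the empty product is $1$). The sum over an empty set of trees is $0$. *)

theory Defs
  imports "Graph_Theory.Digraph_Component" "Jordan_Normal_Form.Matrix"
begin

text \<open>
  A simple digraph is a \<^term>\<open>pair_digraph\<close>: finite, loop-free, and with pairs as arcs, so
  that parallel arcs cannot occur while opposite arcs can.  The arc \<open>(i, j)\<close> goes
  from \<open>i\<close> to \<open>j\<close>.
\<close>

text \<open>
  The library's \<^term>\<open>connected\<close> is connectedness of the underlying undirected graph, but its
  \<^term>\<open>forest\<close> only excludes directed cycles.  A cycle of the underlying undirected graph is
  either a pair of opposite arcs of \<open>T\<close> (or a loop), or a cycle with at least three edges in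
  the symmetric closure; closed walks of length two in the symmetric closure just
  traverse one edge back and forth and are not cycles.
\<close>

definition underlying_acyclic :: "'v pair_pre_digraph \<Rightarrow> bool" where
  "underlying_acyclic T \<longleftrightarrow>
     (\<forall>u v. (u, v) \<in> parcs T \<longrightarrow> (v, u) \<notin> parcs T) \<and>
     \<not> (\<exists>p. pre_digraph.cycle (with_proj (mk_symmetric (with_proj T))) p \<and> 3 \<le> length p)"

definition directed_tree :: "'v pair_pre_digraph \<Rightarrow> bool" where
  "directed_tree T \<longleftrightarrow>
     pair_digraph T \<and>
     (\<forall>v \<in> pverts T. in_degree (with_proj T) v \<le> 1) \<and>
     connected (with_proj T) \<and>
     underlying_acyclic T"

text \<open>
  The vertex at which one arrives, and has to stop, on following arcs backwards from any vertex.
\<close>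

definition is_root :: "'v pair_pre_digraph \<Rightarrow> 'v \<Rightarrow> bool" where
  "is_root T r \<longleftrightarrow>
     r \<in> pverts T \<and>
     in_arcs (with_proj T) r = {} \<and>
     (\<forall>v \<in> pverts T. reachable (with_proj T) r v)"

definition rooted_spanning_tree ::
    "'v pair_pre_digraph \<Rightarrow> 'v \<Rightarrow> 'v pair_pre_digraph \<Rightarrow> bool" where
  "rooted_spanning_tree G i T \<longleftrightarrow>
     spanning (with_proj T) (with_proj G) \<and> directed_tree T \<and> is_root T i"

definition wt :: "('v \<Rightarrow> 'v \<Rightarrow> 'a :: comm_ring_1) \<Rightarrow> 'v pair_pre_digraph \<Rightarrow> 'a" where
  "wt a H = (\<Prod>(i, j) \<in> parcs H. a i j)"

text \<open>
  Matrix and vector indices start at 0, so index \<open>i\<close> belongs to the vertex \<open>Suc i\<close>.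
  The values of the weight function \<open>a\<close> off the arcs of \<open>G\<close> are irrelevant.
\<close>

definition adjacency_matrix ::
    "nat \<Rightarrow> nat pair_pre_digraph \<Rightarrow> (nat \<Rightarrow> nat \<Rightarrow> 'a :: comm_ring_1) \<Rightarrow> 'a mat" where
  "adjacency_matrix n G a =
     mat n n (\<lambda>(i, j). if (Suc i, Suc j) \<in> parcs G then a (Suc i) (Suc j) else 0)"

definition degree_matrix ::
    "nat \<Rightarrow> nat pair_pre_digraph \<Rightarrow> (nat \<Rightarrow> nat \<Rightarrow> 'a :: comm_ring_1) \<Rightarrow> 'a mat" where
  "degree_matrix n G a =
     mat n n (\<lambda>(i, j). if i = j then \<Sum>k<n. adjacency_matrix n G a $$ (k, i) else 0)"

definition laplacian ::
    "nat \<Rightarrow> nat pair_pre_digraph \<Rightarrow> (nat \<Rightarrow> nat \<Rightarrow> 'a :: comm_ring_1) \<Rightarrow> 'a mat" where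
  "laplacian n G a = degree_matrix n G a - adjacency_matrix n G a"

definition harmonic ::
    "nat \<Rightarrow> nat pair_pre_digraph \<Rightarrow> (nat \<Rightarrow> nat \<Rightarrow> 'a :: comm_ring_1) \<Rightarrow> 'a vec \<Rightarrow> bool" where
  "harmonic n G a x \<longleftrightarrow> x \<in> carrier_vec n \<and> laplacian n G a *\<^sub>v x = 0\<^sub>v n"

definition weight_vector ::
    "nat \<Rightarrow> nat pair_pre_digraph \<Rightarrow> (nat \<Rightarrow> nat \<Rightarrow> 'a :: comm_ring_1) \<Rightarrow> 'a vec" where
  "weight_vector n G a = vec n (\<lambda>i. \<Sum>T | rooted_spanning_tree G (Suc i) T. wt a T)"

end

theory Submission
  imports Defs
begin

text \<open>
  Row \<open>i\<close> of \<open>L w = 0\<close> says that \<open>(\<Sum>k. a k i) * w i = (\<Sum>j. a i j * w j)\<close>.  Expanded, the left side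
  runs over pairs of an arc \<open>(k, i)\<close> and an \<open>i\<close>-tree, the right side over pairs of an arc \<open>(i, j)\<close> and
  a \<open>j\<close>-tree.  In both cases, adding the arc to the tree gives a spanning set of arcs in which
  every vertex has exactly one incoming arc and every vertex can be reached from \<open>i\<close>.  Such a set
  contains exactly one directed cycle, and \<open>i\<close> lies on it.  Conversely, the
  cycle enters \<open>i\<close> by one arc and leaves it by one arc: deleting the former
  leaves an \<open>i\<close>-tree, and deleting the latter, \<open>(i, j)\<close>, leaves a \<open>j\<close>-tree.  So both sides are the
  total weight of these unicyclic sets (lemmas \<open>bij_betw_add_arc_to_root\<close> and
  \<open>bij_betw_add_arc_from\<close>).

  The argument is easiest for trees given as sets of arcs with at most one arc into
  each vertex, none into the root, and every vertex reachable from the root.  That these are the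
  rooted spanning trees is \<open>rooted_spanning_tree_iff\<close>; the point to be shown there is that such a set
  has no undirected cycle.
\<close>

section \<open>Arborescences as sets of arcs\<close>

definition arborescence :: "'v set \<Rightarrow> 'v \<Rightarrow> 'v rel \<Rightarrow> bool" where
  "arborescence V r E \<longleftrightarrow>
     r \<in> V \<and> E \<subseteq> V \<times> V \<and> r \<notin> Range E \<and> single_valued (E\<inverse>) \<and> (\<forall>v\<in>V. (r, v) \<in> E\<^sup>*)"

text \<open>
  Going backwards from a vertex on a directed cycle one never leaves the cycle, because arcs into a
  vertex are unique.  But from every vertex one gets back to the root, where there is no arc to
  follow.
\<close>

lemma arborescence_acyclic:
  assumes "arborescence V r E"
  shows "acyclic E"
proof -
  have sv: "single_valued (E\<inverse>)" and root: "r \<notin> Range E" and sub: "E \<subseteq> V \<times> V"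
    and reach: "\<And>v. v \<in> V \<Longrightarrow> (r, v) \<in> E\<^sup>*"
    using assms by (auto simp: arborescence_def)
  have "(v, v) \<notin> E\<^sup>+" if "(r, v) \<in> E\<^sup>*" for v
    using that
  proof (induction rule: rtrancl_induct)
    case base
    show ?case using root by (metis Range.intros tranclE)
  next
    case (step u v)
    show ?case
    proof
      assume "(v, v) \<in> E\<^sup>+"
      then obtain x where x: "(v, x) \<in> E\<^sup>*" "(x, v) \<in> E"
        by (meson tranclD2)
      then have "x = u"
        using sv step.hyps(2) by (meson converse_iff single_valuedD)
      with x step.hyps(2) have "(u, u) \<in> E\<^sup>+" by (simp add: rtrancl_into_trancl2)
      with step.IH show False ..
    qed
  qed
  moreover have "v \<in> V" if "(v, v) \<in> E\<^sup>+" for v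
    using that sub by (metis SigmaD1 subsetD tranclD)
  ultimately show ?thesis using reach by (auto simp: acyclic_def)
qed

text \<open>
  Here \<open>w\<close> lists the vertices of a closed walk without repeated vertices, which at steps \<open>a\<close> and
  \<open>b\<close> traverses the same edge in opposite directions.  Each of the two steps has to follow the other
  one, cyclically, so there is no room for a third.
\<close>

lemma back_and_forth_length_le_2:
  fixes w :: "nat \<Rightarrow> 'v"
  assumes inj: "inj_on w {1..l}" and closed: "w 0 = w l"
    and bounds: "a < l" "b < l"
    and step: "w a = w (Suc b)" "w (Suc a) = w b"
  shows "l \<le> 2"
proof -
  have eq: "x = y" if "w x = w y" "1 \<le> x" "x \<le> l" "1 \<le> y" "y \<le> l" for x y
    using inj_onD[OF inj that(1)] that by auto
  have "(if a = 0 then l else a) = Suc b"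
    by (rule eq) (use step(1) closed bounds in \<open>cases "a = 0"; simp\<close>)+
  moreover have "Suc a = (if b = 0 then l else b)"
    by (rule eq) (use step(2) closed bounds in \<open>cases "b = 0"; simp\<close>)+
  ultimately show ?thesis using bounds by (cases "a = 0"; cases "b = 0"; simp)
qed

lemma pawalk_verts_nth:
  assumes "pcas u p v"
  shows "length (pawalk_verts u p) = Suc (length p)"
    and "pawalk_verts u p ! 0 = u"
    and "pawalk_verts u p ! length p = v"
    and "\<And>k. k < length p \<Longrightarrow> p ! k = (pawalk_verts u p ! k, pawalk_verts u p ! Suc k)"
proof -
  have "length (pawalk_verts u p) = Suc (length p) \<and> pawalk_verts u p ! 0 = u \<and>
    pawalk_verts u p ! length p = v \<and>
    (\<forall>k < length p. p ! k = (pawalk_verts u p ! k, pawalk_verts u p ! Suc k))"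
    using assms
  proof (induction p arbitrary: u)
    case (Cons e p)
    then show ?case by (cases e) (auto simp: nth_Cons split: nat.splits)
  qed simp
  then show "length (pawalk_verts u p) = Suc (length p)"
    and "pawalk_verts u p ! 0 = u"
    and "pawalk_verts u p ! length p = v"
    and "\<And>k. k < length p \<Longrightarrow> p ! k = (pawalk_verts u p ! k, pawalk_verts u p ! Suc k)"
    by auto
qed

text \<open>
  By acyclicity an undirected cycle has a vertex from which no arc leads to a vertex of the cycle.
  Both edges of the cycle at this vertex are then arcs into it, hence the same arc.
\<close>

lemma arborescence_underlying_acyclic:
  assumes arb: "arborescence (pverts T) r (parcs T)" and fin: "finite (parcs T)"
  shows "underlying_acyclic T"
  unfolding underlying_acyclic_def
proof (intro conjI allI impI notI)
  have acyc: "acyclic (parcs T)" by (rule arborescence_acyclic[OF arb])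
  have sv: "single_valued ((parcs T)\<inverse>)" using arb by (simp add: arborescence_def)
  show False if "(u, v) \<in> parcs T" "(v, u) \<in> parcs T" for u v
    using that acyc by (meson acyclic_def r_into_trancl' trancl_into_trancl)
  assume "\<exists>p. pre_digraph.cycle (with_proj (mk_symmetric (with_proj T))) p \<and> 3 \<le> length p"
  then obtain p u where long: "3 \<le> length p"
    and arcs: "set p \<subseteq> parcs (mk_symmetric (with_proj T))"
    and walk: "pcas u p u"
    and dist: "distinct (tl (pawalk_verts u p))"
    by (auto simp: pre_digraph.cycle_def pre_digraph.awalk_def cas_with_proj_eq
        awalk_verts_with_proj_eq)
  define w where "w k = pawalk_verts u p ! k" for k
  let ?l = "length p"
  note W = pawalk_verts_nth[OF walk, folded w_def]
  have inj: "inj_on w {1..?l}"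
  proof (rule inj_onI)
    fix x y assume xy: "x \<in> {1..?l}" "y \<in> {1..?l}" "w x = w y"
    then have "tl (pawalk_verts u p) ! (x - 1) = tl (pawalk_verts u p) ! (y - 1)"
      using W(1) by (auto simp: nth_tl w_def)
    with dist xy W(1) have "x - 1 = y - 1"
      by (subst (asm) nth_eq_iff_index_eq) auto
    with xy show "x = y" by auto
  qed
  have edge: "(w k, w (Suc k)) \<in> parcs T \<or> (w (Suc k), w k) \<in> parcs T" if "k < ?l" for k
    using W(4)[OF that] arcs nth_mem[OF that] by (auto simp: parcs_mk_symmetric)
  have "wf ((parcs T)\<inverse>)" using acyc fin by (rule finite_acyclic_wf_converse[rotated])
  moreover have "w 0 \<in> w ` {..<?l}" using long by (intro imageI) auto
  ultimately obtain m where m: "m \<in> w ` {..<?l}"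
    and top: "\<And>y. (y, m) \<in> (parcs T)\<inverse> \<Longrightarrow> y \<notin> w ` {..<?l}"
    by (rule wfE_min) blast
  obtain a where a: "a < ?l" "w a = m" using m by auto
  have on_cycle: "w k \<in> w ` {..<?l}" if "k \<le> ?l" for k
  proof (cases "k = ?l")
    case True
    then have "w k = w 0" using W by simp
    then show ?thesis using long by auto
  qed (use that in auto)
  obtain b where b: "b < ?l" "w (Suc b) = m"
  proof (cases "a = 0")
    case True
    then show ?thesis using that[of "?l - 1"] long W a by auto
  next
    case False
    then show ?thesis using that[of "a - 1"] a by auto
  qed
  have "(w (Suc a), m) \<in> parcs T"
    using edge[OF a(1)] top[of "w (Suc a)"] on_cycle[of "Suc a"] a by auto
  moreover have "(w b, m) \<in> parcs T"
    using edge[OF b(1)] top[of "w b"] on_cycle[of b] b by auto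
  ultimately have "w (Suc a) = w b" using sv by (meson converse_iff single_valuedD)
  with a b W have "?l \<le> 2"
    by (intro back_and_forth_length_le_2[OF inj _ a(1) b(1)]) auto
  with long show False by simp
qed

lemma reachable_iff_rtrancl:
  assumes "pair_wf_digraph T" "u \<in> pverts T"
  shows "reachable (with_proj T) u v \<longleftrightarrow> (u, v) \<in> (parcs T)\<^sup>*"
proof
  interpret pair_wf_digraph T by fact
  assume "(u, v) \<in> (parcs T)\<^sup>*"
  then show "reachable (with_proj T) u v"
  proof (induction rule: rtrancl_induct)
    case base
    then show ?case using assms by (simp add: reachable_refl)
  next
    case (step y z)
    then show ?case by (auto intro: reachable_adj_trans)
  qed
next
  interpret pair_wf_digraph T by fact
  assume "reachable (with_proj T) u v"
  then show "(u, v) \<in> (parcs T)\<^sup>*"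
    using reachable_rtranclI[of "with_proj T"] by simp
qed

lemma in_degree_le_1_iff:
  assumes "pair_fin_digraph T"
  shows "(\<forall>v\<in>pverts T. in_degree (with_proj T) v \<le> 1) \<longleftrightarrow> single_valued ((parcs T)\<inverse>)"
proof -
  interpret pair_fin_digraph T by fact
  have "in_degree (with_proj T) v \<le> 1 \<longleftrightarrow>
      (\<forall>u u'. (u, v) \<in> parcs T \<longrightarrow> (u', v) \<in> parcs T \<longrightarrow> u = u')" for v
  proof -
    have "finite (in_arcs (with_proj T) v)"
      using pair_finite_arcs by (auto simp: in_arcs_def)
    then show ?thesis
      by (auto simp: in_degree_def card_le_Suc0_iff_eq in_arcs_def)
  qed
  then show ?thesis
    by (auto simp: single_valued_def dest: in_arcsD2)
qed

lemma rooted_spanning_tree_iff: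
  assumes G: "pair_digraph G"
  shows "rooted_spanning_tree G r T \<longleftrightarrow>
    pverts T = pverts G \<and> parcs T \<subseteq> parcs G \<and> arborescence (pverts G) r (parcs T)"
    (is "_ \<longleftrightarrow> ?R")
proof
  assume L: "rooted_spanning_tree G r T"
  then have T: "pair_digraph T" by (simp add: rooted_spanning_tree_def directed_tree_def)
  interpret T: pair_digraph T by fact
  from L have "pverts T = pverts G" "parcs T \<subseteq> parcs G"
    by (auto simp: rooted_spanning_tree_def spanning_def subgraph_def)
  moreover have "single_valued ((parcs T)\<inverse>)"
    using L in_degree_le_1_iff[OF T.pair_fin_digraph_axioms]
    by (auto simp: rooted_spanning_tree_def directed_tree_def)
  moreover have "r \<in> pverts T" "r \<notin> Range (parcs T)" "\<forall>v\<in>pverts T. (r, v) \<in> (parcs T)\<^sup>*"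
    using L reachable_iff_rtrancl[OF T.pair_wf_digraph_axioms]
    by (auto simp: rooted_spanning_tree_def is_root_def in_arcs_def)
  moreover have "parcs T \<subseteq> pverts T \<times> pverts T" using T.wellformed' by auto
  ultimately show ?R by (auto simp: arborescence_def)
next
  interpret G: pair_digraph G by fact
  assume R: ?R
  then have V: "pverts T = pverts G" and sub: "parcs T \<subseteq> parcs G"
    and arb: "arborescence (pverts T) r (parcs T)" by auto
  then have "parcs T \<subseteq> pverts T \<times> pverts T" by (simp add: arborescence_def)
  moreover have "finite (parcs T)" by (rule finite_subset[OF sub G.pair_finite_arcs])
  ultimately interpret T: pair_digraph T
    using V sub G.pair_no_loops G.pair_finite_verts by unfold_locales auto
  have r: "r \<in> pverts T" using arb by (simp add: arborescence_def)
  have reach: "reachable (with_proj T) r v" if "v \<in> pverts T" for v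
    using that arb reachable_iff_rtrancl[OF T.pair_wf_digraph_axioms r]
    by (auto simp: arborescence_def)
  have "spanning (with_proj T) (with_proj G)"
    using V sub T.wf_digraph_axioms G.wf_digraph_axioms
    by (auto simp: spanning_def subgraph_def compatible_def)
  moreover have "is_root T r"
    using r reach arb by (auto simp: is_root_def in_arcs_def arborescence_def)
  moreover have "connected (with_proj T)"
  proof -
    interpret S: pair_wf_digraph "mk_symmetric (with_proj T)" ..
    have "symmetric (with_proj (mk_symmetric (with_proj T)))" by (rule symmetric_mk_symmetric)
    then have "reachable (mk_symmetric (with_proj T)) u v"
      if "u \<in> pverts T" "v \<in> pverts T" for u v
      using T.reachable_mk_symmetricI[OF reach] that
      by (meson S.reachable_trans symmetric_reachable)
    then show ?thesis using r by (auto simp: connected_def strongly_connected_def)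
  qed
  moreover have "\<forall>v\<in>pverts T. in_degree (with_proj T) v \<le> 1"
    using arb in_degree_le_1_iff[OF T.pair_fin_digraph_axioms] by (simp add: arborescence_def)
  moreover have "underlying_acyclic T"
    by (rule arborescence_underlying_acyclic[OF arb T.pair_finite_arcs])
  ultimately show "rooted_spanning_tree G r T"
    using T.pair_digraph by (simp add: rooted_spanning_tree_def directed_tree_def)
qed

section \<open>Closing a tree to a unicyclic set of arcs\<close>

definition arborescences :: "'v set \<Rightarrow> 'v rel \<Rightarrow> 'v \<Rightarrow> 'v rel set" where
  "arborescences V F r = {E. E \<subseteq> F \<and> arborescence V r E}"

text \<open>
  Some arc \<open>(k, i)\<close> enters \<open>i\<close> and \<open>k\<close> can be reached from \<open>i\<close>, so \<open>i\<close> lies on a directed cycle.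
  There is no other one: going backwards from any vertex along the unique incoming arcs leads to
  \<open>i\<close>, and then around the cycle of \<open>i\<close> only.
\<close>

definition unicyclic_through :: "'v set \<Rightarrow> 'v rel \<Rightarrow> 'v \<Rightarrow> 'v rel set" where
  "unicyclic_through V F i =
     {H. H \<subseteq> F \<and> H \<subseteq> V \<times> V \<and> i \<in> V \<and> i \<in> Range H \<and> single_valued (H\<inverse>) \<and> (\<forall>v\<in>V. (i, v) \<in> H\<^sup>*)}"

lemma rtrancl_avoid_arcs_into_source:
  assumes "(i, v) \<in> H\<^sup>*"
  shows "(i, v) \<in> (H - UNIV \<times> {i})\<^sup>*"
  using assms
proof (induction rule: rtrancl_induct)
  case (step u v)
  then show ?case by (cases "v = i") (auto intro: rtrancl_into_rtrancl)
qed simp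

lemma rtrancl_avoid_arcs_out_of_target:
  assumes "(v, i) \<in> H\<^sup>*"
  shows "(v, i) \<in> (H - {i} \<times> UNIV)\<^sup>*"
  using assms
proof (induction rule: converse_rtrancl_induct)
  case (step u v)
  then show ?case by (cases "u = i") (auto intro: converse_rtrancl_into_rtrancl)
qed simp

text \<open>Arcs into \<open>i\<close> are useless for reaching a vertex from \<open>i\<close>, so the deleted one is not missed.\<close>

lemma bij_betw_add_arc_to_root:
  assumes F: "F \<subseteq> V \<times> V"
  shows "bij_betw (\<lambda>(k, E). insert (k, i) E) ({k. (k, i) \<in> F} \<times> arborescences V F i)
    (unicyclic_through V F i)"
  unfolding bij_betw_def
proof (intro conjI equalityI subsetI)
  show "inj_on (\<lambda>(k, E). insert (k, i) E) ({k. (k, i) \<in> F} \<times> arborescences V F i)"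
  proof (rule inj_onI, clarify)
    fix k E k' E'
    assume E: "E \<in> arborescences V F i" and E': "E' \<in> arborescences V F i"
      and eq: "insert (k, i) E = insert (k', i) E'"
    have "(x, i) \<notin> E" "(x, i) \<notin> E'" for x
      using E E' by (auto simp: arborescences_def arborescence_def)
    with eq show "k = k' \<and> E = E'" by (metis insert_ident insert_iff prod.inject)
  qed
next
  fix H assume "H \<in> (\<lambda>(k, E). insert (k, i) E) ` ({k. (k, i) \<in> F} \<times> arborescences V F i)"
  then obtain k E where k: "(k, i) \<in> F" and E: "E \<subseteq> F" "arborescence V i E"
    and H: "H = insert (k, i) E" by (auto simp: arborescences_def)
  have "(i, v) \<in> H\<^sup>*" if "v \<in> V" for v
    using E that rtrancl_mono[of E H] unfolding H by (auto simp: arborescence_def subset_iff)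
  then show "H \<in> unicyclic_through V F i"
    using k E F H by (auto simp: unicyclic_through_def arborescence_def single_valued_def)
next
  fix H assume H: "H \<in> unicyclic_through V F i"
  then obtain k where k: "(k, i) \<in> H" by (auto simp: unicyclic_through_def)
  then have only: "x = k" if "(x, i) \<in> H" for x
    using H that by (auto simp: unicyclic_through_def single_valued_def)
  then have "H - UNIV \<times> {i} = H - {(k, i)}" by auto
  then have "\<forall>v\<in>V. (i, v) \<in> (H - {(k, i)})\<^sup>*"
    using H rtrancl_avoid_arcs_into_source[of i _ H] by (auto simp: unicyclic_through_def)
  then have "H - {(k, i)} \<in> arborescences V F i"
    using H only
    by (auto simp: arborescences_def unicyclic_through_def arborescence_def single_valued_def)
  moreover have "(k, i) \<in> F" using H k by (auto simp: unicyclic_through_def)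
  moreover have "H = insert (k, i) (H - {(k, i)})" using k by auto
  ultimately show "H \<in> (\<lambda>(k, E). insert (k, i) E) ` ({k. (k, i) \<in> F} \<times> arborescences V F i)"
    by (intro image_eqI[of _ _ "(k, H - {(k, i)})"]) auto
qed

text \<open>
  Here \<open>i\<close> may have several outgoing arcs, and only the one on the cycle may be deleted: after
  deleting any other, the cycle would remain, which gives injectivity.  The right arc \<open>(i, j)\<close> is the
  first one on a closed walk from \<open>i\<close> to itself.
\<close>

lemma bij_betw_add_arc_from:
  assumes F: "F \<subseteq> V \<times> V"
  shows "bij_betw (\<lambda>(j, E). insert (i, j) E) (SIGMA j:{j. (i, j) \<in> F}. arborescences V F j)
    (unicyclic_through V F i)"
  unfolding bij_betw_def
proof (intro conjI equalityI subsetI)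
  show "inj_on (\<lambda>(j, E). insert (i, j) E) (SIGMA j:{j. (i, j) \<in> F}. arborescences V F j)"
  proof (rule inj_onI, clarify)
    fix j E j' E'
    assume ij: "(i, j) \<in> F" and E: "E \<in> arborescences V F j" and E': "E' \<in> arborescences V F j'"
      and eq: "insert (i, j) E = insert (i, j') E'"
    have notin: "(i, j) \<notin> E" "(i, j') \<notin> E'"
      using E E' by (auto simp: arborescences_def arborescence_def)
    have "j = j'"
    proof (rule ccontr)
      assume "j \<noteq> j'"
      with eq notin have "(i, j) \<in> E'" by auto
      have "(j, i) \<in> E\<^sup>*"
        using E ij F by (auto simp: arborescences_def arborescence_def)
      then have "(j, i) \<in> (E - {i} \<times> UNIV)\<^sup>*" by (rule rtrancl_avoid_arcs_out_of_target)
      moreover have "E - {i} \<times> UNIV \<subseteq> E'" using eq by auto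
      ultimately have "(j, i) \<in> E'\<^sup>*" using rtrancl_mono by blast
      with \<open>(i, j) \<in> E'\<close> have "(i, i) \<in> E'\<^sup>+" by (rule rtrancl_into_trancl2)
      moreover have "acyclic E'"
        using E' arborescence_acyclic by (auto simp: arborescences_def)
      ultimately show False by (auto simp: acyclic_def)
    qed
    with eq notin show "j = j' \<and> E = E'" by (metis insert_ident)
  qed
next
  fix H assume "H \<in> (\<lambda>(j, E). insert (i, j) E) ` (SIGMA j:{j. (i, j) \<in> F}. arborescences V F j)"
  then obtain j E where j: "(i, j) \<in> F" and E: "E \<subseteq> F" "arborescence V j E"
    and H: "H = insert (i, j) E" by (auto simp: arborescences_def)
  have reach: "(i, v) \<in> H\<^sup>+" if "v \<in> V" for v
  proof (rule rtrancl_into_trancl2)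
    show "(i, j) \<in> H" using H by simp
    show "(j, v) \<in> H\<^sup>*" using E that rtrancl_mono[of E H] unfolding H
      by (auto simp: arborescence_def subset_iff)
  qed
  have i: "i \<in> V" using j F by auto
  \<comment> \<open>The arc into \<open>i\<close> is the last one of the walk \<open>i \<rightarrow> j \<rightarrow> \<dots> \<rightarrow> i\<close>.\<close>
  have "i \<in> Range H" using reach[OF i] by (metis Range.intros tranclE)
  moreover have "(i, v) \<in> H\<^sup>*" if "v \<in> V" for v using reach[OF that] by simp
  ultimately show "H \<in> unicyclic_through V F i"
    using i j E F H by (auto simp: unicyclic_through_def arborescence_def single_valued_def)
next
  fix H assume H: "H \<in> unicyclic_through V F i"
  have HV: "H \<subseteq> V \<times> V" and HF: "H \<subseteq> F" using H by (auto simp: unicyclic_through_def)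
  obtain k where k: "(k, i) \<in> H" using H by (auto simp: unicyclic_through_def)
  then have "(i, k) \<in> H\<^sup>*" using H by (auto simp: unicyclic_through_def)
  with k have "(i, i) \<in> H\<^sup>+" by (simp add: rtrancl_into_trancl1)
  then obtain j where j: "(i, j) \<in> H" and ji: "(j, i) \<in> H\<^sup>*" by (meson tranclD)
  let ?E = "H - {(i, j)}"
  have "(j, i) \<in> ?E\<^sup>*"
    using rtrancl_avoid_arcs_out_of_target[OF ji] rtrancl_mono[of "H - {i} \<times> UNIV" ?E] by auto
  have "(j, v) \<in> ?E\<^sup>*" if "(i, v) \<in> H\<^sup>*" for v
    using that
  proof (induction rule: rtrancl_induct)
    case base
    show ?case by fact
  next
    case (step x y)
    then show ?case by (cases "(x, y) = (i, j)") (auto intro: rtrancl_into_rtrancl)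
  qed
  moreover have "j \<notin> Range ?E"
    using H j by (auto simp: unicyclic_through_def single_valued_def)
  ultimately have "?E \<in> arborescences V F j"
    using H j by (auto simp: arborescences_def unicyclic_through_def arborescence_def
        single_valued_def)
  moreover have "(i, j) \<in> F" using HF j by auto
  moreover have "H = insert (i, j) ?E" using j by auto
  ultimately show
    "H \<in> (\<lambda>(j, E). insert (i, j) E) ` (SIGMA j:{j. (i, j) \<in> F}. arborescences V F j)"
    by (intro image_eqI[of _ _ "(j, ?E)"]) auto
qed

section \<open>Balance of tree weights at a vertex\<close>

definition arc_weight :: "('v \<Rightarrow> 'v \<Rightarrow> 'a :: comm_ring_1) \<Rightarrow> 'v rel \<Rightarrow> 'a" where
  "arc_weight a E = (\<Prod>(i, j)\<in>E. a i j)"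

lemma arborescence_weight_balance:
  fixes a :: "'v \<Rightarrow> 'v \<Rightarrow> 'a :: comm_ring_1"
  assumes fin: "finite F" and F: "F \<subseteq> V \<times> V"
  shows "(\<Sum>k | (k, i) \<in> F. a k i) * (\<Sum>E\<in>arborescences V F i. arc_weight a E) =
    (\<Sum>j | (i, j) \<in> F. a i j * (\<Sum>E\<in>arborescences V F j. arc_weight a E))"
proof -
  have fin_arb: "finite (arborescences V F r)" for r
    by (rule finite_subset[of _ "Pow F"]) (use fin in \<open>auto simp: arborescences_def\<close>)
  have fin_out: "finite {j. (i, j) \<in> F}"
    by (rule finite_subset[of _ "snd ` F"]) (use fin in force)+
  have weight: "a x y * arc_weight a E = arc_weight a (insert (x, y) E)"
    if "E \<in> arborescences V F r" "(x, y) \<notin> E" for r E x y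
  proof -
    have "finite E" using that fin by (auto simp: arborescences_def intro: finite_subset)
    then show ?thesis using that by (simp add: arc_weight_def)
  qed
  have notin: "(x, r) \<notin> E" if "E \<in> arborescences V F r" for x r E
    using that by (auto simp: arborescences_def arborescence_def)
  have "(\<Sum>k | (k, i) \<in> F. a k i) * (\<Sum>E\<in>arborescences V F i. arc_weight a E) =
      (\<Sum>(k, E)\<in>{k. (k, i) \<in> F} \<times> arborescences V F i. a k i * arc_weight a E)"
    by (simp add: sum_product sum.cartesian_product)
  also have "\<dots> = (\<Sum>x\<in>{k. (k, i) \<in> F} \<times> arborescences V F i.
      arc_weight a ((\<lambda>(k, E). insert (k, i) E) x))"
    by (intro sum.cong) (auto intro!: weight dest: notin)
  also have "\<dots> = (\<Sum>H\<in>unicyclic_through V F i. arc_weight a H)"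
    by (rule sum.reindex_bij_betw[OF bij_betw_add_arc_to_root[OF F]])
  also have "\<dots> = (\<Sum>x\<in>(SIGMA j:{j. (i, j) \<in> F}. arborescences V F j).
      arc_weight a ((\<lambda>(j, E). insert (i, j) E) x))"
    by (rule sum.reindex_bij_betw[OF bij_betw_add_arc_from[OF F], symmetric])
  also have "\<dots> = (\<Sum>(j, E)\<in>(SIGMA j:{j. (i, j) \<in> F}. arborescences V F j).
      a i j * arc_weight a E)"
    by (intro sum.cong) (auto intro!: weight[symmetric] dest: notin)
  also have "\<dots> = (\<Sum>j | (i, j) \<in> F. a i j * (\<Sum>E\<in>arborescences V F j. arc_weight a E))"
    using fin_arb fin_out by (simp add: sum.Sigma[symmetric] sum_distrib_left)
  finally show ?thesis .
qed

lemma sum_rooted_spanning_tree_weights: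
  assumes "pair_digraph G"
  shows "(\<Sum>T | rooted_spanning_tree G r T. wt a T) =
    (\<Sum>E\<in>arborescences (pverts G) (parcs G) r. arc_weight a E)"
  by (rule sum.reindex_bij_witness[where i = "\<lambda>E. \<lparr>pverts = pverts G, parcs = E\<rparr>" and j = parcs])
    (auto simp: rooted_spanning_tree_iff[OF assms] arborescences_def wt_def arc_weight_def)

theorem theorem1:
  fixes n :: nat
    and G :: "nat pair_pre_digraph"
    and a :: "nat \<Rightarrow> nat \<Rightarrow> 'a :: comm_ring_1"
  assumes "pair_digraph G"
    and "pverts G = {1..n}"
  shows "harmonic n G a (weight_vector n G a)"
proof -
  interpret pair_digraph G by fact
  let ?A = "adjacency_matrix n G a"
  define W where "W r = (\<Sum>T | rooted_spanning_tree G r T. wt a T)" for r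
  have arcs: "parcs G \<subseteq> pverts G \<times> pverts G" using wellformed' by auto
  have range: "x \<in> Suc ` {..<n} \<and> y \<in> Suc ` {..<n}" if "(x, y) \<in> parcs G" for x y
    using that arcs assms(2) by (auto simp: image_Suc_lessThan)
  have balance: "(\<Sum>k | (k, i) \<in> parcs G. a k i) * W i = (\<Sum>j | (i, j) \<in> parcs G. a i j * W j)" for i
    unfolding W_def sum_rooted_spanning_tree_weights[OF assms(1)]
    by (rule arborescence_weight_balance[OF pair_finite_arcs arcs])
  have shift: "(\<Sum>k<n. if P (Suc k) then f (Suc k) else 0) = (\<Sum>k | P k. f k)"
    if "\<And>k. P k \<Longrightarrow> k \<in> Suc ` {..<n}" for P and f :: "nat \<Rightarrow> 'a"
  proof -
    have "(\<Sum>k<n. if P (Suc k) then f (Suc k) else 0) = (\<Sum>k\<in>Suc ` {..<n}. if P k then f k else 0)"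
      by (simp add: sum.reindex)
    also have "\<dots> = (\<Sum>k\<in>{k \<in> Suc ` {..<n}. P k}. f k)"
      by (rule sum.inter_filter[symmetric]) simp
    also have "{k \<in> Suc ` {..<n}. P k} = {k. P k}" using that by auto
    finally show ?thesis .
  qed
  have row: "(\<Sum>j<n. laplacian n G a $$ (i, j) * W (Suc j)) = 0" if i: "i < n" for i
  proof -
    have "(\<Sum>j<n. laplacian n G a $$ (i, j) * W (Suc j)) =
        (\<Sum>j<n. (if i = j then (\<Sum>k<n. ?A $$ (k, i)) * W (Suc i) else 0) - ?A $$ (i, j) * W (Suc j))"
      using i by (intro sum.cong)
        (auto simp: laplacian_def degree_matrix_def adjacency_matrix_def algebra_simps)
    also have "\<dots> = (\<Sum>k<n. ?A $$ (k, i)) * W (Suc i) - (\<Sum>j<n. ?A $$ (i, j) * W (Suc j))"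
      using i by (simp add: sum_subtractf)
    also have "(\<Sum>k<n. ?A $$ (k, i)) = (\<Sum>k | (k, Suc i) \<in> parcs G. a k (Suc i))"
      using i range by (subst shift[symmetric]) (auto simp: adjacency_matrix_def)
    also have "(\<Sum>j<n. ?A $$ (i, j) * W (Suc j)) =
        (\<Sum>j | (Suc i, j) \<in> parcs G. a (Suc i) j * W j)"
      using i range by (subst shift[symmetric]) (auto simp: adjacency_matrix_def intro!: sum.cong)
    finally show ?thesis using balance[of "Suc i"] by simp
  qed
  have "laplacian n G a *\<^sub>v weight_vector n G a = 0\<^sub>v n"
  proof (rule eq_vecI)
    fix i assume "i < dim_vec (0\<^sub>v n :: 'a vec)"
    then have i: "i < n" by simp
    have "(laplacian n G a *\<^sub>v weight_vector n G a) $ i =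
        (\<Sum>j<n. laplacian n G a $$ (i, j) * W (Suc j))"
      using i by (auto simp: laplacian_def degree_matrix_def adjacency_matrix_def weight_vector_def
          W_def scalar_prod_def lessThan_atLeast0 intro!: sum.cong)
    then show "(laplacian n G a *\<^sub>v weight_vector n G a) $ i = 0\<^sub>v n $ i"
      using row[OF i] i by simp
  qed (simp add: laplacian_def adjacency_matrix_def)
  then show ?thesis by (simp add: harmonic_def weight_vector_def)
qed

end
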